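(* Let $R$ be a ring and let $I \subsetneq J$ be ideals in $R$. Then: (i) If $I^n = J^n$ for some $n \geq 2$, then $I J^{n-1} = J^n$, so that $I$ is a reduction of $J$. Thus, in particular, if an ideal $J$ in a ring $R$ admits no proper reduction (i.e. no ideal $I\subsetneq J$ is a reduction of $J$), then $J$ is a big ideal. Further, $I J^{n-1} = J^n$ with $n \geq 2$ does not imply $I^n = J^n$; that is, there exist a ring $R$, ideals $I\subsetneq J$ of $R$ and an integer $n\geq 2$ such that $IJ^{n-1}=J^n$ but $I^n\neq J^n$. (ii) If $I^n = J^n$ for some $n \geq 1$, then $I^m = J^m$ for all $m \geq n$. (iii) If $R$ is Noetherian, then $I^n = J^n$ for some $n \geq 1$ if and only if $R[Jt]/R[It]$ is a finitely generated $R$-module.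
   Context: All rings are commutative with identity $1\neq 0$. For ideals $I\subset J$ of a ring $R$, $I$ is a reduction of $J$ if $IJ^m = J^{m+1}$ for some $m\geq 1$. An ideal $J$ of $R$ is called a big ideal if for every ideal $I\subsetneq J$ one has $I^n\subsetneq J^n$ for all $n\geq 1$. For an ideal $I$ of $R$, $R[It]=\bigoplus_{k\ge 0} I^k t^k\subseteq R[t]$ denotes the Rees algebra, $t$ an indeterminate; $R[Jt]/R[It]$ is the quotient as $R$-modules. *)

theory Defs
  imports "HOL-Algebra.Algebra" Complex_Main
begin

text \<open>Ideals under \<^const>\<open>ideal_prod\<close> form the multiplicative part of \<^const>\<open>ideals_set\<close>, so
  powers of ideals are its monoid powers; in particular the zeroth power is the whole ring.\<close>

abbreviation ideal_pow :: "('a, 'b) ring_scheme \<Rightarrow> 'a set \<Rightarrow> nat \<Rightarrow> 'a set" where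
  "ideal_pow R I n \<equiv> I [^]\<^bsub>ideals_set R\<^esub> n"

lemma ideal_pow_0: "ideal_pow R I 0 = carrier R"
  by (simp add: nat_pow_def ideals_set_def)

lemma ideal_pow_Suc: "ideal_pow R I (Suc n) = ideal_prod R (ideal_pow R I n) I"
  by (simp add: nat_pow_def ideals_set_def)

lemma (in ring) ideal_pow_is_ideal: "ideal I R \<Longrightarrow> ideal (ideal_pow R I n) R"
  by (induction n) (simp_all add: ideals_set_def oneideal ideal_prod_is_ideal)

definition reduction :: "('a, 'b) ring_scheme \<Rightarrow> 'a set \<Rightarrow> 'a set \<Rightarrow> bool" where
  "reduction R I J \<longleftrightarrow> ideal I R \<and> ideal J R \<and> I \<subseteq> J \<and>
     (\<exists>m\<ge>1. ideal_prod R I (ideal_pow R J m) = ideal_pow R J (m + 1))"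

definition big_ideal :: "('a, 'b) ring_scheme \<Rightarrow> 'a set \<Rightarrow> bool" where
  "big_ideal R J \<longleftrightarrow> ideal J R \<and>
     (\<forall>I. ideal I R \<and> I \<subset> J \<longrightarrow> (\<forall>n\<ge>1. ideal_pow R I n \<subset> ideal_pow R J n))"

text \<open>The quotient of \<open>M\<close> by a submodule \<open>N\<close>. A module record extends a ring record, but the
  module axioms ignore its multiplicative part, which is left unspecified.\<close>

definition quot_module :: "('r, 'a, 'm) module_scheme \<Rightarrow> 'a set \<Rightarrow> ('r, 'a set) module" where
  "quot_module M N =
     \<lparr>carrier = a_rcosets\<^bsub>M\<^esub> N, monoid.mult = undefined, one = undefined,
      ring.zero = N, add = set_add M,
      smult = (\<lambda>a A. \<Union>x\<in>A. N +>\<^bsub>M\<^esub> (a \<odot>\<^bsub>M\<^esub> x))\<rparr>"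

definition fin_gen_module :: "('r, 'b) ring_scheme \<Rightarrow> ('r, 'a, 'm) module_scheme \<Rightarrow> bool" where
  "fin_gen_module R M \<longleftrightarrow> (\<exists>S. finite S \<and> S \<subseteq> carrier M \<and>
     (\<forall>x\<in>carrier M. \<exists>c\<in>S \<rightarrow> carrier R. x = (\<Oplus>\<^bsub>M\<^esub>s\<in>S. c s \<odot>\<^bsub>M\<^esub> s)))"

definition rees :: "('a, 'b) ring_scheme \<Rightarrow> 'a set \<Rightarrow> (nat \<Rightarrow> 'a) set" where
  "rees R I = {p \<in> carrier (UP R). \<forall>k. coeff (UP R) p k \<in> ideal_pow R I k}"

text \<open>The Rees algebra as an \<open>R\<close>-module (even an \<open>R\<close>-algebra), with the operations of \<open>R[t]\<close>.\<close>

definition rees_algebra :: "('a, 'b) ring_scheme \<Rightarrow> 'a set \<Rightarrow> ('a, nat \<Rightarrow> 'a) up_ring" where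
  "rees_algebra R I = (UP R)\<lparr>carrier := rees R I\<rparr>"


subsection \<open>The constructions yield modules\<close>

lemma (in module) quot_module_smult_coset:
  assumes N: "submodule N R M" and a: "a \<in> carrier R" and x: "x \<in> carrier M"
  shows "a \<odot>\<^bsub>quot_module M N\<^esub> (N +>\<^bsub>M\<^esub> x) = N +>\<^bsub>M\<^esub> (a \<odot>\<^bsub>M\<^esub> x)"
proof -
  interpret N: submodule N R M by (rule N)
  interpret S: abelian_subgroup N M
    by (rule abelian_subgroupI3) (simp_all add: additive_subgroup_def N.subgroup_axioms M.abelian_group_axioms)
  have "N +>\<^bsub>M\<^esub> (a \<odot>\<^bsub>M\<^esub> y) = N +>\<^bsub>M\<^esub> (a \<odot>\<^bsub>M\<^esub> x)" if y: "y \<in> N +>\<^bsub>M\<^esub> x" for y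
  proof -
    from y obtain n where n: "n \<in> N" "y = n \<oplus>\<^bsub>M\<^esub> x" by (auto simp: a_r_coset_def')
    have nM: "n \<in> carrier M" using n S.a_subset by auto
    have "a \<odot>\<^bsub>M\<^esub> y = a \<odot>\<^bsub>M\<^esub> n \<oplus>\<^bsub>M\<^esub> a \<odot>\<^bsub>M\<^esub> x" using n nM a x by (simp add: smult_r_distr)
    then have "a \<odot>\<^bsub>M\<^esub> y \<in> N +>\<^bsub>M\<^esub> (a \<odot>\<^bsub>M\<^esub> x)"
      using n a by (auto simp: a_r_coset_def')
    then show ?thesis using a x S.a_repr_independence' by (metis smult_closed)
  qed
  moreover have "x \<in> N +>\<^bsub>M\<^esub> x" using x S.a_rcos_self by blast
  ultimately have "(\<Union>y\<in>N +>\<^bsub>M\<^esub> x. N +>\<^bsub>M\<^esub> (a \<odot>\<^bsub>M\<^esub> y)) = N +>\<^bsub>M\<^esub> (a \<odot>\<^bsub>M\<^esub> x)"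
    by blast
  then show ?thesis by (simp only: quot_module_def module.select_convs)
qed

lemma (in module) quot_module_is_module:
  assumes N: "submodule N R M"
  shows "module R (quot_module M N)"
proof -
  interpret N: submodule N R M by (rule N)
  interpret S: abelian_subgroup N M
    by (rule abelian_subgroupI3) (simp_all add: additive_subgroup_def N.subgroup_axioms M.abelian_group_axioms)
  let ?Q = "quot_module M N"
  have carr: "carrier ?Q = (\<lambda>x. N +>\<^bsub>M\<^esub> x) ` carrier M"
    by (auto simp: quot_module_def A_RCOSETS_def')
  have add: "(N +>\<^bsub>M\<^esub> x) \<oplus>\<^bsub>?Q\<^esub> (N +>\<^bsub>M\<^esub> y) = N +>\<^bsub>M\<^esub> (x \<oplus>\<^bsub>M\<^esub> y)"
    if "x \<in> carrier M" "y \<in> carrier M" for x y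
    using that S.a_rcos_sum by (simp add: quot_module_def)
  have zero: "\<zero>\<^bsub>?Q\<^esub> = N +>\<^bsub>M\<^esub> \<zero>\<^bsub>M\<^esub>"
    using S.a_subset by (simp add: quot_module_def)
  note smult = quot_module_smult_coset[OF N]
  have cosetI: "N +>\<^bsub>M\<^esub> x \<in> carrier ?Q" if "x \<in> carrier M" for x
    using that carr by blast
  have cosetE: "\<exists>y\<in>carrier M. x = N +>\<^bsub>M\<^esub> y" if "x \<in> carrier ?Q" for x
    using that carr by blast
  show ?thesis
  proof (rule moduleI)
    show "abelian_group ?Q"
    proof (rule abelian_groupI)
      fix x y assume "x \<in> carrier ?Q" "y \<in> carrier ?Q"
      then obtain x' y' where *: "x' \<in> carrier M" "x = N +>\<^bsub>M\<^esub> x'" "y' \<in> carrier M" "y = N +>\<^bsub>M\<^esub> y'"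
        using cosetE by metis
      show "x \<oplus>\<^bsub>?Q\<^esub> y \<in> carrier ?Q" using * by (simp add: add cosetI)
      show "x \<oplus>\<^bsub>?Q\<^esub> y = y \<oplus>\<^bsub>?Q\<^esub> x" using * by (simp add: add M.a_comm)
    next
      show "\<zero>\<^bsub>?Q\<^esub> \<in> carrier ?Q" unfolding zero by (rule cosetI) simp
    next
      fix x y z assume "x \<in> carrier ?Q" "y \<in> carrier ?Q" "z \<in> carrier ?Q"
      then obtain x' y' z' where "x' \<in> carrier M" "x = N +>\<^bsub>M\<^esub> x'" "y' \<in> carrier M" "y = N +>\<^bsub>M\<^esub> y'"
        "z' \<in> carrier M" "z = N +>\<^bsub>M\<^esub> z'"
        using cosetE by metis
      then show "(x \<oplus>\<^bsub>?Q\<^esub> y) \<oplus>\<^bsub>?Q\<^esub> z = x \<oplus>\<^bsub>?Q\<^esub> (y \<oplus>\<^bsub>?Q\<^esub> z)" by (simp add: add M.a_assoc)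
    next
      fix x assume "x \<in> carrier ?Q"
      then obtain x' where *: "x' \<in> carrier M" "x = N +>\<^bsub>M\<^esub> x'" using cosetE by blast
      show "\<zero>\<^bsub>?Q\<^esub> \<oplus>\<^bsub>?Q\<^esub> x = x" unfolding zero *(2) using *(1) by (subst add) simp_all
      have "(N +>\<^bsub>M\<^esub> (\<ominus>\<^bsub>M\<^esub> x')) \<oplus>\<^bsub>?Q\<^esub> x = \<zero>\<^bsub>?Q\<^esub>"
        unfolding zero *(2) using *(1) by (subst add) (simp_all add: M.l_neg)
      then show "\<exists>y\<in>carrier ?Q. y \<oplus>\<^bsub>?Q\<^esub> x = \<zero>\<^bsub>?Q\<^esub>" using cosetI *(1) by blast
    qed
  next
    fix a x y assume ab: "a \<in> carrier R" and "x \<in> carrier ?Q" "y \<in> carrier ?Q"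
    then obtain x' y' where *: "x' \<in> carrier M" "x = N +>\<^bsub>M\<^esub> x'" "y' \<in> carrier M" "y = N +>\<^bsub>M\<^esub> y'"
      using cosetE by metis
    show "a \<odot>\<^bsub>?Q\<^esub> (x \<oplus>\<^bsub>?Q\<^esub> y) = a \<odot>\<^bsub>?Q\<^esub> x \<oplus>\<^bsub>?Q\<^esub> a \<odot>\<^bsub>?Q\<^esub> y"
      using ab * by (simp add: add smult smult_r_distr)
  next
    fix a b x assume ab: "a \<in> carrier R" "b \<in> carrier R" and "x \<in> carrier ?Q"
    then obtain x' where *: "x' \<in> carrier M" "x = N +>\<^bsub>M\<^esub> x'" using cosetE by blast
    show "(a \<oplus>\<^bsub>R\<^esub> b) \<odot>\<^bsub>?Q\<^esub> x = a \<odot>\<^bsub>?Q\<^esub> x \<oplus>\<^bsub>?Q\<^esub> b \<odot>\<^bsub>?Q\<^esub> x"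
      using ab * by (simp add: add smult smult_l_distr)
    show "(a \<otimes>\<^bsub>R\<^esub> b) \<odot>\<^bsub>?Q\<^esub> x = a \<odot>\<^bsub>?Q\<^esub> (b \<odot>\<^bsub>?Q\<^esub> x)"
      using ab * by (simp add: smult smult_assoc1)
  next
    fix a x assume a: "a \<in> carrier R" and "x \<in> carrier ?Q"
    then obtain x' where *: "x' \<in> carrier M" "x = N +>\<^bsub>M\<^esub> x'" using cosetE by blast
    show "a \<odot>\<^bsub>?Q\<^esub> x \<in> carrier ?Q" using a * by (simp add: smult cosetI)
  next
    fix x assume "x \<in> carrier ?Q"
    then obtain x' where *: "x' \<in> carrier M" "x = N +>\<^bsub>M\<^esub> x'" using cosetE by blast
    show "\<one>\<^bsub>R\<^esub> \<odot>\<^bsub>?Q\<^esub> x = x" using * by (simp add: smult)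
  qed (rule R.is_cring)
qed

lemma (in cring) rees_submodule_UP:
  assumes I: "ideal I R"
  shows "submodule (rees R I) R (UP R)"
proof -
  interpret P: UP_cring R "UP R" by unfold_locales
  interpret Q: ideal "ideal_pow R I k" R for k by (rule ideal_pow_is_ideal[OF I])
  show ?thesis
  proof (rule module.submoduleI)
    show "module R (UP R)" using P.UP_algebra algebra.module by blast
  qed (auto simp: rees_def Q.I_l_closed)
qed

lemma (in cring) rees_algebra_is_module:
  assumes I: "ideal I R"
  shows "module R (rees_algebra R I)"
proof -
  interpret P: UP_cring R "UP R" by unfold_locales
  show ?thesis unfolding rees_algebra_def
    using submodule.submodule_is_module[OF rees_submodule_UP[OF I]] P.UP_algebra algebra.module
    by blast
qed

lemma (in ring) ideal_pow_mono:
  assumes "ideal J R" "I \<subseteq> J"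
  shows "ideal_pow R I n \<subseteq> ideal_pow R J n"
proof (induction n)
  case (Suc n)
  have "x \<in> ideal_prod R (ideal_pow R J n) J" if "x \<in> ideal_prod R (ideal_pow R I n) I" for x
    using that by induction (use Suc assms in \<open>auto intro: ideal_prod.intros\<close>)
  then show ?case unfolding ideal_pow_Suc by blast
qed (simp add: ideal_pow_0)

lemma (in cring) rees_submodule:
  assumes "ideal I R" "ideal J R" "I \<subseteq> J"
  shows "submodule (rees R I) R (rees_algebra R J)"
proof (rule module.module_incl_imp_submodule)
  show "module R (rees_algebra R J)" by (rule rees_algebra_is_module[OF assms(2)])
  show "rees R I \<subseteq> carrier (rees_algebra R J)"
    using ideal_pow_mono[OF assms(2,3)] by (auto simp: rees_algebra_def rees_def)
  show "module R ((rees_algebra R J)\<lparr>carrier := rees R I\<rparr>)"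
    using rees_algebra_is_module[OF assms(1)] by (simp add: rees_algebra_def)
qed

end

theory Submission
  imports Defs
begin

text \<open>If \<open>I\<^sup>n = J\<^sup>n\<close>, then \<open>J\<^sup>n = I I\<^sup>n\<^sup>-\<^sup>1 \<subseteq> I J\<^sup>n\<^sup>-\<^sup>1 \<subseteq> J\<^sup>n\<close>; multiplying by \<open>J\<close> gives the next power.
  The quotient \<open>R[Jt]/R[It]\<close> is graded with components \<open>J\<^sup>k/I\<^sup>k\<close>. Finitely many generators have
  bounded degree, so finite generation forces \<open>J\<^sup>k = I\<^sup>k\<close> for large \<open>k\<close>; conversely, if the powers
  agree from \<open>n\<close> on, generators of the ideals \<open>J\<^sup>k\<close> for \<open>k < n\<close> suffice.\<close>

section \<open>Powers of ideals\<close>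

lemma ideal_prod_mono:
  assumes "A \<subseteq> C" "B \<subseteq> D"
  shows "ideal_prod R A B \<subseteq> ideal_prod R C D"
proof
  fix x assume "x \<in> ideal_prod R A B"
  then show "x \<in> ideal_prod R C D"
    by induction (use assms in \<open>auto intro: ideal_prod.intros\<close>)
qed

context cring
begin

lemma ideal_pow_1:
  assumes "ideal I R"
  shows "ideal_pow R I 1 = I"
  unfolding One_nat_def ideal_pow_Suc ideal_pow_0
  by (simp only: ideal_prod_commute[OF oneideal assms] ideal_prod_one[OF assms])

lemma ideal_pow_Suc_left:
  assumes "ideal I R"
  shows "ideal_pow R I (Suc n) = ideal_prod R I (ideal_pow R I n)"
  unfolding ideal_pow_Suc by (rule ideal_prod_commute[OF ideal_pow_is_ideal[OF assms] assms])

text \<open>The exponent is written \<open>Suc n\<close> so that a factor I can be split off. Both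
  inclusions are monotonicity: I J^n \<subseteq> J J^n, and J^(n+1) = I I^n \<subseteq> I
  J^n.\<close>

lemma ideal_prod_ideal_pow_eq:
  assumes "ideal I R" "ideal J R" "I \<subseteq> J"
    and "ideal_pow R I (Suc n) = ideal_pow R J (Suc n)"
  shows "ideal_prod R I (ideal_pow R J n) = ideal_pow R J (Suc n)"
proof
  show "ideal_prod R I (ideal_pow R J n) \<subseteq> ideal_pow R J (Suc n)"
    unfolding ideal_pow_Suc_left[OF assms(2)] using assms(3) by (rule ideal_prod_mono) simp
  show "ideal_pow R J (Suc n) \<subseteq> ideal_prod R I (ideal_pow R J n)"
    unfolding assms(4)[symmetric] ideal_pow_Suc_left[OF assms(1)]
    by (intro ideal_prod_mono ideal_pow_mono assms order_refl)
qed

text \<open>One factor J is exchanged at a time: J^(n+2) = (I J^n) J = I J^(n+1) = I I^(n+1), the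
  last step by hypothesis.\<close>

lemma ideal_pow_eq_Suc:
  assumes "ideal I R" "ideal J R" "I \<subseteq> J"
    and "ideal_pow R I (Suc n) = ideal_pow R J (Suc n)"
  shows "ideal_pow R I (Suc (Suc n)) = ideal_pow R J (Suc (Suc n))"
proof -
  note pow = ideal_pow_is_ideal[OF assms(2)]
  have "ideal_pow R J (Suc (Suc n)) = ideal_prod R (ideal_prod R I (ideal_pow R J n)) J"
    by (simp only: ideal_prod_ideal_pow_eq[OF assms] ideal_pow_Suc[of R J "Suc n"])
  also have "\<dots> = ideal_prod R I (ideal_pow R J (Suc n))"
    by (simp only: ideal_prod_assoc[OF assms(1) pow assms(2)] ideal_pow_Suc)
  also have "\<dots> = ideal_pow R I (Suc (Suc n))"
    by (simp only: ideal_pow_Suc_left[OF assms(1), of "Suc n"] assms(4))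
  finally show ?thesis by simp
qed

text \<open>Induction upwards from \<open>n\<close>. Positivity of \<open>n\<close> matters: zeroth
  powers always agree, being the whole ring.\<close>

lemma ideal_pow_eq_mono:
  assumes "ideal I R" "ideal J R" "I \<subseteq> J" "1 \<le> n" "n \<le> m"
    and "ideal_pow R I n = ideal_pow R J n"
  shows "ideal_pow R I m = ideal_pow R J m"
  using assms(5)
proof (induction m rule: dec_induct)
  case base
  show ?case by (rule assms(6))
next
  case (step m)
  then obtain k where "m = Suc k" using assms(4) by (cases m) auto
  with step ideal_pow_eq_Suc[OF assms(1-3)] show ?case by simp
qed

section \<open>Reductions and big ideals\<close>

lemma reduction_if_ideal_pow_eq:
  assumes "ideal I R" "ideal J R" "I \<subseteq> J" "2 \<le> n"
    and "ideal_pow R I n = ideal_pow R J n"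
  shows "ideal_prod R I (ideal_pow R J (n - 1)) = ideal_pow R J n" "reduction R I J"
proof -
  \<comment> \<open>The exponent \<open>k\<close> = n - 1 is the witness in
    \<open>reduction\<close>, which asks for a positive one; this is where \<open>n\<close> \<ge> 2
    enters.\<close>
  obtain k where n: "n = Suc k" "1 \<le> k" using assms(4) by (cases n) auto
  have eq: "ideal_prod R I (ideal_pow R J k) = ideal_pow R J (Suc k)"
    using assms n by (intro ideal_prod_ideal_pow_eq) auto
  then show "ideal_prod R I (ideal_pow R J (n - 1)) = ideal_pow R J n" by (simp add: n)
  show "reduction R I J" using assms(1-3) eq n(2) by (auto simp: reduction_def)
qed

text \<open>By contradiction: an equality of powers with n \<ge> 2 would make I a proper reduction.
  The case n = 1 is separate, since there the equality reads I = J and contradicts strict inclusion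
  directly.\<close>

lemma big_ideal_if_no_reduction:
  assumes J: "ideal J R" and "\<nexists>I. ideal I R \<and> I \<subset> J \<and> reduction R I J"
  shows "big_ideal R J"
  unfolding big_ideal_def
proof (intro conjI allI impI J)
  fix I and n :: nat assume I: "ideal I R \<and> I \<subset> J" and n: "1 \<le> n"
  have "ideal_pow R I n \<noteq> ideal_pow R J n"
  proof
    assume eq: "ideal_pow R I n = ideal_pow R J n"
    show False
    proof (cases "n = 1")
      case True
      with eq I J show False using ideal_pow_1 by blast
    next
      case False
      with n have "2 \<le> n" by simp
      with eq I assms reduction_if_ideal_pow_eq(2) show False by blast
    qed
  qed
  with I J show "ideal_pow R I n \<subset> ideal_pow R J n" using ideal_pow_mono by blast
qed

end


section \<open>A reduction with different powers\<close>

text \<open>The lattice d\<int> + e\<i>\<int> in the complex plane. One family covers the ring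
  \<int>[2\<i>], both ideals, \<int>[\<i>] itself and the bound for I^2, so that membership
  questions become divisibility questions.\<close>

definition gauss_lattice :: "int \<Rightarrow> int \<Rightarrow> complex set" where
  "gauss_lattice d e = range (\<lambda>(a, b). Complex (of_int (d * a)) (of_int (e * b)))"

definition order_2i :: "complex ring" where
  "order_2i = \<lparr>carrier = gauss_lattice 1 2, monoid.mult = (*), one = 1, ring.zero = 0, add = (+)\<rparr>"

lemma gauss_latticeI:
  assumes "z = Complex (of_int (d * a)) (of_int (e * b))"
  shows "z \<in> gauss_lattice d e"
  using assms by (auto simp: gauss_lattice_def)

lemma gauss_latticeE:
  assumes "z \<in> gauss_lattice d e"
  obtains a b where "z = Complex (of_int (d * a)) (of_int (e * b))"
  using assms by (auto simp: gauss_lattice_def)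

text \<open>Serves to exclude 2\<i> from I and 4\<i> from I^2.\<close>

lemma gauss_lattice_imaginary:
  assumes "Complex 0 (of_int y) \<in> gauss_lattice d e"
  shows "e dvd y"
proof -
  obtain a b where "Complex 0 (of_int y) = Complex (of_int (d * a)) (of_int (e * b))"
    by (rule gauss_latticeE[OF assms])
  then have "real_of_int y = real_of_int (e * b)" unfolding complex.inject by (rule conjunct2)
  then show ?thesis unfolding of_int_eq_iff by simp
qed

lemma gauss_lattice_0: "0 \<in> gauss_lattice d e"
  by (rule gauss_latticeI[of _ d 0 e 0]) (simp add: complex_eq_iff)

lemma gauss_lattice_uminus: "- z \<in> gauss_lattice d e" if "z \<in> gauss_lattice d e"
  using that
proof (rule gauss_latticeE)
  fix a b assume "z = Complex (of_int (d * a)) (of_int (e * b))"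
  then show ?thesis
    by (intro gauss_latticeI[of _ d "- a" e "- b"]) (simp add: complex_eq_iff)
qed

lemma gauss_lattice_add:
  assumes "z \<in> gauss_lattice d e" "w \<in> gauss_lattice d e"
  shows "z + w \<in> gauss_lattice d e"
proof -
  obtain a b a' b' where "z = Complex (of_int (d * a)) (of_int (e * b))"
    "w = Complex (of_int (d * a')) (of_int (e * b'))"
    using assms by (metis gauss_latticeE)
  then show ?thesis
    by (intro gauss_latticeI[of _ d "a + a'" e "b + b'"]) (simp add: complex_eq_iff algebra_simps)
qed

text \<open>The real part of a product is built from multiples of dd' and ee', the imaginary part
  from multiples of de' and ed'; hence the four divisibilities. Closure of the ring, absorption by
  the ideals and the bound for I^2 are all instances.\<close>

lemma gauss_lattice_mult:
  assumes z: "z \<in> gauss_lattice d e" and w: "w \<in> gauss_lattice d' e'"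
    and dvd: "f dvd d * d'" "f dvd e * e'" "g dvd d * e'" "g dvd e * d'"
  shows "z * w \<in> gauss_lattice f g"
proof -
  obtain a b a' b' where zw: "z = Complex (of_int (d * a)) (of_int (e * b))"
    "w = Complex (of_int (d' * a')) (of_int (e' * b'))"
    using z w by (metis gauss_latticeE)
  have "f dvd (d * d') * (a * a') - (e * e') * (b * b')"
    "g dvd (d * e') * (a * b') + (e * d') * (b * a')"
    by (intro dvd_diff dvd_add dvd_mult2 dvd)+
  then obtain k l where "(d * d') * (a * a') - (e * e') * (b * b') = f * k"
    "(d * e') * (a * b') + (e * d') * (b * a') = g * l"
    by (auto elim!: dvdE)
  \<comment> \<open>Divisibility is settled over the integers; casting both equations to the reals
    turns them into the coordinates of \<open>z * w\<close>.\<close>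
  from arg_cong[OF this(1), of real_of_int] arg_cong[OF this(2), of real_of_int]
  show ?thesis
    by (intro gauss_latticeI[of _ f k g l]) (simp add: zw complex_eq_iff algebra_simps)
qed

section \<open>The ring \<int>[2\<i>] and its lattice ideals\<close>

lemma order_2i_cring: "cring order_2i"
proof (rule cringI)
  show "abelian_group order_2i"
  proof (rule abelian_groupI)
    fix x assume "x \<in> carrier order_2i"
    then show "\<exists>y\<in>carrier order_2i. y \<oplus>\<^bsub>order_2i\<^esub> x = \<zero>\<^bsub>order_2i\<^esub>"
      by (auto simp: order_2i_def intro: bexI[of _ "- x"] gauss_lattice_uminus)
  qed (auto simp: order_2i_def gauss_lattice_0 gauss_lattice_add algebra_simps)
  have "1 \<in> gauss_lattice 1 2"
    by (rule gauss_latticeI[of _ 1 1 2 0]) (simp add: complex_eq_iff)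
  then show "comm_monoid order_2i"
    by (intro comm_monoidI) (auto simp: order_2i_def intro: gauss_lattice_mult)
qed (auto simp: order_2i_def algebra_simps)

text \<open>Evenness of \<open>e\<close> places the lattice inside \<int>[2\<i>]. Multiplication by
  2\<i> turns a real part d into an imaginary part 2d and an imaginary part e into a real part -2e,
  which the other two conditions keep in the lattice.\<close>

lemma order_2i_ideal:
  assumes "even e" "d dvd 2 * e" "e dvd 2 * d"
  shows "ideal (gauss_lattice d e) order_2i"
proof (rule idealI)
  interpret cring order_2i by (rule order_2i_cring)
  show "ring order_2i" by (rule ring_axioms)
  have subset: "gauss_lattice d e \<subseteq> carrier order_2i"
  proof
    fix z assume "z \<in> gauss_lattice d e"
    then obtain a b where "z = Complex (of_int (d * a)) (of_int (e * b))" by (rule gauss_latticeE)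
    moreover obtain k where "e = 2 * k" using assms(1) by blast
    ultimately show "z \<in> carrier order_2i"
      unfolding order_2i_def by (simp, intro gauss_latticeI[of _ 1 "d * a" 2 "k * b"]) simp
  qed
  show "subgroup (gauss_lattice d e) (add_monoid order_2i)"
  proof (rule add.subgroupI)
    fix z assume z: "z \<in> gauss_lattice d e"
    \<comment> \<open>The inverse of the ring record is defined abstractly; uniqueness of additive
      inverses identifies it with complex negation.\<close>
    have "\<ominus>\<^bsub>order_2i\<^esub> z = - z"
      using z subset gauss_lattice_uminus[OF z]
      by (intro minus_equality) (auto simp: order_2i_def)
    then show "\<ominus>\<^bsub>order_2i\<^esub> z \<in> gauss_lattice d e"
      using gauss_lattice_uminus[OF z] by simp
  qed (use subset gauss_lattice_0[of d e] in \<open>auto simp: order_2i_def gauss_lattice_add\<close>)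
next
  fix z w assume "z \<in> gauss_lattice d e" "w \<in> carrier order_2i"
  then have "w * z \<in> gauss_lattice d e"
    using assms by (auto simp: order_2i_def intro: gauss_lattice_mult)
  then show "w \<otimes>\<^bsub>order_2i\<^esub> z \<in> gauss_lattice d e" "z \<otimes>\<^bsub>order_2i\<^esub> w \<in> gauss_lattice d e"
    by (simp_all add: order_2i_def mult.commute)
qed

text \<open>In \<open>S = \<int>[2\<i>]\<close> take \<open>I = 2S\<close> and \<open>J = 2\<int>[\<i>]\<close>: as \<open>2\<i> \<in> S\<close>, both \<open>IJ\<close> and
  \<open>J\<^sup>2\<close> equal \<open>4\<int>[\<i>]\<close>, whereas \<open>I\<^sup>2 = 4S\<close> does not contain \<open>4\<i>\<close>.\<close>

lemma reduction_with_different_powers: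
  "\<exists>(S :: complex ring) I J n. cring S \<and> \<one>\<^bsub>S\<^esub> \<noteq> \<zero>\<^bsub>S\<^esub> \<and>
    ideal I S \<and> ideal J S \<and> I \<subset> J \<and> 2 \<le> n \<and>
    ideal_prod S I (ideal_pow S J (n - 1)) = ideal_pow S J n \<and>
    ideal_pow S I n \<noteq> ideal_pow S J n"
proof -
  interpret cring order_2i by (rule order_2i_cring)
  let ?I = "gauss_lattice 2 4" and ?J = "gauss_lattice 2 2"
  have I: "ideal ?I order_2i" and J: "ideal ?J order_2i" by (rule order_2i_ideal; simp)+
  have two: "2 \<in> ?I" by (rule gauss_latticeI[of _ 2 1 4 0]) (simp add: complex_eq_iff)
  have two_i: "Complex 0 2 \<in> ?J" by (rule gauss_latticeI[of _ 2 0 2 1]) simp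
  have "?I \<subseteq> ?J"
  proof
    fix z assume "z \<in> ?I"
    then obtain a b where "z = Complex (of_int (2 * a)) (of_int (4 * b))" by (rule gauss_latticeE)
    then show "z \<in> ?J" by (intro gauss_latticeI[of _ 2 a 2 "2 * b"]) simp
  qed
  moreover have "Complex 0 2 \<notin> ?I"
    using gauss_lattice_imaginary[of 2 2 4] by auto
  ultimately have psub: "?I \<subset> ?J" using two_i by blast
  have pow2: "ideal_pow order_2i K 2 = ideal_prod order_2i K K" if "ideal K order_2i" for K
    using ideal_pow_Suc[of order_2i K 1] ideal_pow_1[OF that] by (simp only: Suc_1)
  \<comment> \<open>A generator z w of J^2 has z = 2u with u in \<int>[\<i>]. Moving u to the other
    factor gives 2 (u w) with 2 in I and u w in J, as J is closed under multiplication by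
    \<int>[\<i>].\<close>
  have "x \<in> ideal_prod order_2i ?I ?J" if "x \<in> ideal_prod order_2i ?J ?J" for x
    using that
  proof induction
    case (prod z w)
    then obtain a b where "z = Complex (of_int (2 * a)) (of_int (2 * b))" by (elim gauss_latticeE)
    then have "z = 2 * Complex (of_int a) (of_int b)" by (simp add: complex_eq_iff)
    moreover have "Complex (of_int a) (of_int b) * w \<in> ?J"
      by (rule gauss_lattice_mult[of _ 1 1]) (use prod in \<open>auto intro: gauss_latticeI\<close>)
    ultimately show ?case
      using ideal_prod.prod[OF two, of "Complex (of_int a) (of_int b) * w" ?J order_2i]
      by (simp add: order_2i_def mult.assoc)
  qed (rule ideal_prod.sum)
  moreover have "ideal_prod order_2i ?I ?J \<subseteq> ideal_prod order_2i ?J ?J"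
    using \<open>?I \<subseteq> ?J\<close> by (intro ideal_prod_mono) auto
  ultimately have IJ: "ideal_prod order_2i ?I ?J = ideal_prod order_2i ?J ?J" by blast
  \<comment> \<open>Only an upper bound for I^2 is required: 4\<int> + 8\<i>\<int> already misses
    4\<i>, while 4\<i> = 2 (2\<i>) lies in J^2.\<close>
  have "x \<in> gauss_lattice 4 8" if "x \<in> ideal_prod order_2i ?I ?I" for x
    using that
  proof induction
    case (prod z w)
    then have "z * w \<in> gauss_lattice 4 8" by (rule gauss_lattice_mult) auto
    then show ?case by (simp add: order_2i_def)
  next
    case (sum z w)
    then have "z + w \<in> gauss_lattice 4 8" by (intro gauss_lattice_add)
    then show ?case by (simp add: order_2i_def)
  qed
  moreover have "Complex 0 4 \<notin> gauss_lattice 4 8"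
    using gauss_lattice_imaginary[of 4 4 8] by auto
  moreover have "2 * Complex 0 2 \<in> ideal_prod order_2i ?J ?J"
    using ideal_prod.prod[of 2 ?J "Complex 0 2" ?J order_2i] two two_i \<open>?I \<subseteq> ?J\<close>
    by (auto simp: order_2i_def)
  then have "Complex 0 4 \<in> ideal_prod order_2i ?J ?J" by (simp add: complex_eq_iff times_complex.code)
  ultimately have "ideal_prod order_2i ?I ?I \<noteq> ideal_prod order_2i ?J ?J" by blast
  moreover have "ideal_pow order_2i ?J (2 - 1) = ?J" using ideal_pow_1[OF J] by simp
  ultimately show ?thesis
    using I J psub IJ order_2i_cring pow2[OF I] pow2[OF J]
    by (intro exI[of _ order_2i] exI[of _ ?I] exI[of _ ?J] exI[of _ 2]) (simp add: order_2i_def)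
qed


section \<open>Finitely generated quotients\<close>

text \<open>Induction on the index set; an infinite one is covered because \<open>finsum\<close>
  then takes its default value zero, which lies in \<open>H\<close>.\<close>

lemma (in abelian_monoid) finsum_mem:
  assumes "H \<subseteq> carrier G" "\<zero> \<in> H" "\<And>x y. x \<in> H \<Longrightarrow> y \<in> H \<Longrightarrow> x \<oplus> y \<in> H" "f \<in> A \<rightarrow> H"
  shows "finsum G f A \<in> H"
  using assms(4)
proof (induction A rule: infinite_finite_induct)
  case (insert a A)
  then have "f \<in> A \<rightarrow> carrier G" "f a \<in> carrier G" using assms(1) by auto
  with insert show ?case by (simp add: assms(3))
qed (simp_all add: assms(2))

context module
begin

text \<open>Closure under negation follows from scalar multiplication by -1.\<close>

lemma submoduleI_smult:
  assumes "H \<subseteq> carrier M" "\<zero>\<^bsub>M\<^esub> \<in> H" "\<And>x y. x \<in> H \<Longrightarrow> y \<in> H \<Longrightarrow> x \<oplus>\<^bsub>M\<^esub> y \<in> H"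
    and smult: "\<And>a x. a \<in> carrier R \<Longrightarrow> x \<in> H \<Longrightarrow> a \<odot>\<^bsub>M\<^esub> x \<in> H"
  shows "submodule H R M"
proof (rule submoduleI)
  fix x assume x: "x \<in> H"
  then have "\<ominus>\<^bsub>M\<^esub> x = (\<ominus> \<one>) \<odot>\<^bsub>M\<^esub> x" using assms(1) by (subst smult_l_minus) auto
  with smult[OF _ x] show "\<ominus>\<^bsub>M\<^esub> x \<in> H" by simp
qed (use assms in auto)

lemma submodule_zero:
  assumes "submodule H R M"
  shows "\<zero>\<^bsub>M\<^esub> \<in> H"
  using subgroup.one_closed[OF submodule.axioms(1)[OF assms]] by simp

text \<open>Replaces explicit linear combinations by a test on submodules, which transfers easily
  along quotients. Forwards, a submodule containing \<open>S\<close> contains all combinations of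
  \<open>S\<close>; backwards, the test is applied to the span of \<open>S\<close>.\<close>

lemma fin_gen_module_iff:
  "fin_gen_module R M \<longleftrightarrow>
    (\<exists>S. finite S \<and> S \<subseteq> carrier M \<and> (\<forall>H. submodule H R M \<and> S \<subseteq> H \<longrightarrow> H = carrier M))"
proof
  assume "fin_gen_module R M"
  then obtain S where S: "finite S" "S \<subseteq> carrier M"
    and span: "\<And>x. x \<in> carrier M \<Longrightarrow> \<exists>c\<in>S \<rightarrow> carrier R. x = (\<Oplus>\<^bsub>M\<^esub>s\<in>S. c s \<odot>\<^bsub>M\<^esub> s)"
    unfolding fin_gen_module_def by blast
  have "H = carrier M" if H: "submodule H R M" "S \<subseteq> H" for H
  proof
    show "H \<subseteq> carrier M" by (rule submoduleE(1)[OF H(1)])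
    show "carrier M \<subseteq> H"
    proof
      fix x assume "x \<in> carrier M"
      with span obtain c where c: "c \<in> S \<rightarrow> carrier R" "x = (\<Oplus>\<^bsub>M\<^esub>s\<in>S. c s \<odot>\<^bsub>M\<^esub> s)" by blast
      show "x \<in> H"
        unfolding c(2)
        by (rule M.finsum_mem)
          (use c(1) H(2) submodule_zero[OF H(1)] submoduleE(1,4,5)[OF H(1)] in \<open>auto simp: Pi_iff subset_iff\<close>)
    qed
  qed
  with S show "\<exists>S. finite S \<and> S \<subseteq> carrier M \<and> (\<forall>H. submodule H R M \<and> S \<subseteq> H \<longrightarrow> H = carrier M)"
    by blast
next
  assume "\<exists>S. finite S \<and> S \<subseteq> carrier M \<and> (\<forall>H. submodule H R M \<and> S \<subseteq> H \<longrightarrow> H = carrier M)"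
  then obtain S where S: "finite S" "S \<subseteq> carrier M"
    and gen: "\<And>H. submodule H R M \<Longrightarrow> S \<subseteq> H \<Longrightarrow> H = carrier M" by blast
  define H where "H = {(\<Oplus>\<^bsub>M\<^esub>s\<in>S. c s \<odot>\<^bsub>M\<^esub> s) | c. c \<in> S \<rightarrow> carrier R}"
  have term_closed: "(\<lambda>s. c s \<odot>\<^bsub>M\<^esub> s) \<in> S \<rightarrow> carrier M" if "c \<in> S \<rightarrow> carrier R" for c
    using that S(2) by auto
  \<comment> \<open>Membership in the span is reduced to naming coefficients: \<open>f\<close> need
    only agree with a scaled family on \<open>S\<close>.\<close>
  have HI: "(\<Oplus>\<^bsub>M\<^esub>s\<in>S. f s) \<in> H"
    if "c \<in> S \<rightarrow> carrier R" "\<And>s. s \<in> S \<Longrightarrow> f s = c s \<odot>\<^bsub>M\<^esub> s" for c f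
  proof -
    have "(\<Oplus>\<^bsub>M\<^esub>s\<in>S. f s) = (\<Oplus>\<^bsub>M\<^esub>s\<in>S. c s \<odot>\<^bsub>M\<^esub> s)"
      using that term_closed by (intro M.finsum_cong') auto
    with that(1) show ?thesis by (auto simp: H_def)
  qed
  have "submodule H R M"
  proof (rule submoduleI_smult)
    show "H \<subseteq> carrier M" using term_closed by (auto simp: H_def intro: M.finsum_closed)
    have "(\<Oplus>\<^bsub>M\<^esub>s\<in>S. \<zero>\<^bsub>M\<^esub>) \<in> H" by (rule HI[of "\<lambda>_. \<zero>"]) (use S(2) in auto)
    then show "\<zero>\<^bsub>M\<^esub> \<in> H" by simp
  next
    fix x y assume "x \<in> H" "y \<in> H"
    then obtain c d where c: "c \<in> S \<rightarrow> carrier R" "x = (\<Oplus>\<^bsub>M\<^esub>s\<in>S. c s \<odot>\<^bsub>M\<^esub> s)"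
      and d: "d \<in> S \<rightarrow> carrier R" "y = (\<Oplus>\<^bsub>M\<^esub>s\<in>S. d s \<odot>\<^bsub>M\<^esub> s)" by (auto simp: H_def)
    have "x \<oplus>\<^bsub>M\<^esub> y = (\<Oplus>\<^bsub>M\<^esub>s\<in>S. c s \<odot>\<^bsub>M\<^esub> s \<oplus>\<^bsub>M\<^esub> d s \<odot>\<^bsub>M\<^esub> s)"
      unfolding c(2) d(2) by (rule M.finsum_addf[symmetric]) (rule term_closed; fact)+
    also have "\<dots> \<in> H"
      by (rule HI[of "\<lambda>s. c s \<oplus> d s"]) (use c d S(2) in \<open>auto intro!: smult_l_distr[symmetric]\<close>)
    finally show "x \<oplus>\<^bsub>M\<^esub> y \<in> H" .
  next
    fix a x assume a: "a \<in> carrier R" and "x \<in> H"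
    then obtain c where c: "c \<in> S \<rightarrow> carrier R" "x = (\<Oplus>\<^bsub>M\<^esub>s\<in>S. c s \<odot>\<^bsub>M\<^esub> s)"
      by (auto simp: H_def)
    have "a \<odot>\<^bsub>M\<^esub> x = (\<Oplus>\<^bsub>M\<^esub>s\<in>S. a \<odot>\<^bsub>M\<^esub> (c s \<odot>\<^bsub>M\<^esub> s))"
      unfolding c(2) by (rule finsum_smult_ldistr[OF S(1) a term_closed[OF c(1)]])
    also have "\<dots> \<in> H"
      by (rule HI[of "\<lambda>s. a \<otimes> c s"]) (use a c S(2) in \<open>auto intro!: smult_assoc1[symmetric]\<close>)
    finally show "a \<odot>\<^bsub>M\<^esub> x \<in> H" .
  qed
  moreover have "S \<subseteq> H"
  proof
    fix s assume s: "s \<in> S"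
    \<comment> \<open>Indicator coefficients, one at \<open>s\<close> and zero elsewhere, express
      \<open>s\<close> itself.\<close>
    have "(\<Oplus>\<^bsub>M\<^esub>t\<in>S. if s = t then t else \<zero>\<^bsub>M\<^esub>) \<in> H"
      by (rule HI[of "\<lambda>t. if s = t then \<one> else \<zero>"]) (use S(2) in auto)
    also have "(\<Oplus>\<^bsub>M\<^esub>t\<in>S. if s = t then t else \<zero>\<^bsub>M\<^esub>) = s"
      using M.finsum_singleton[OF s S(1), of "\<lambda>t. t"] S(2) by auto
    finally show "s \<in> H" .
  qed
  ultimately have "H = carrier M" by (rule gen)
  with S show "fin_gen_module R M"
    unfolding fin_gen_module_def by (auto simp: H_def intro!: exI[of _ S])
qed

text \<open>Submodules of M/N correspond to submodules of M containing N. Generators are lifted to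
  representatives or projected to cosets, and the test submodules travel the opposite way, by direct
  or inverse image.\<close>

lemma fin_gen_quot_module_iff:
  assumes N: "submodule N R M"
  shows "fin_gen_module R (quot_module M N) \<longleftrightarrow>
    (\<exists>S. finite S \<and> S \<subseteq> carrier M \<and> (\<forall>H. submodule H R M \<and> N \<union> S \<subseteq> H \<longrightarrow> H = carrier M))"
proof -
  interpret N: submodule N R M by (rule N)
  interpret S: abelian_subgroup N M
    by (rule abelian_subgroupI3)
      (simp_all add: additive_subgroup_def N.subgroup_axioms M.abelian_group_axioms)
  let ?Q = "quot_module M N"
  interpret Q: module R ?Q by (rule quot_module_is_module[OF N])
  have carr: "carrier ?Q = (\<lambda>x. N +>\<^bsub>M\<^esub> x) ` carrier M"
    by (auto simp: quot_module_def A_RCOSETS_def')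
  have add: "(N +>\<^bsub>M\<^esub> x) \<oplus>\<^bsub>?Q\<^esub> (N +>\<^bsub>M\<^esub> y) = N +>\<^bsub>M\<^esub> (x \<oplus>\<^bsub>M\<^esub> y)"
    if "x \<in> carrier M" "y \<in> carrier M" for x y
    using that S.a_rcos_sum by (simp add: quot_module_def)
  have zero: "\<zero>\<^bsub>?Q\<^esub> = N" by (simp add: quot_module_def)
  note smult = quot_module_smult_coset[OF N]
  show ?thesis
  proof
    assume "fin_gen_module R ?Q"
    then obtain T where T: "finite T" "T \<subseteq> carrier ?Q"
      and gen: "\<And>K. submodule K R ?Q \<Longrightarrow> T \<subseteq> K \<Longrightarrow> K = carrier ?Q"
      unfolding Q.fin_gen_module_iff by blast
    from finite_subset_image[OF T(1) T(2)[unfolded carr]] obtain S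
      where S: "S \<subseteq> carrier M" "finite S" "T = (\<lambda>x. N +>\<^bsub>M\<^esub> x) ` S" by blast
    have "H = carrier M" if H: "submodule H R M" "N \<union> S \<subseteq> H" for H
    proof
      show sub: "H \<subseteq> carrier M" by (rule submoduleE(1)[OF H(1)])
      let ?K = "(\<lambda>x. N +>\<^bsub>M\<^esub> x) ` H"
      have "submodule ?K R ?Q"
      proof (rule Q.submoduleI_smult)
        show "?K \<subseteq> carrier ?Q" using sub carr by auto
        have "N +>\<^bsub>M\<^esub> \<zero>\<^bsub>M\<^esub> \<in> ?K" using submodule_zero[OF H(1)] by (rule imageI)
        then show "\<zero>\<^bsub>?Q\<^esub> \<in> ?K" using S.a_rcos_const[OF S.zero_closed] by (simp add: zero)
      next
        fix x y assume "x \<in> ?K" "y \<in> ?K"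
        then obtain u v where uv: "u \<in> H" "v \<in> H" "x = N +>\<^bsub>M\<^esub> u" "y = N +>\<^bsub>M\<^esub> v" by blast
        with sub have "x \<oplus>\<^bsub>?Q\<^esub> y = N +>\<^bsub>M\<^esub> (u \<oplus>\<^bsub>M\<^esub> v)" by (simp add: add subset_iff)
        with submoduleE(5)[OF H(1) uv(1,2)] show "x \<oplus>\<^bsub>?Q\<^esub> y \<in> ?K" by simp
      next
        fix a x assume a: "a \<in> carrier R" and "x \<in> ?K"
        then obtain u where u: "u \<in> H" "x = N +>\<^bsub>M\<^esub> u" by blast
        with a sub have "a \<odot>\<^bsub>?Q\<^esub> x = N +>\<^bsub>M\<^esub> (a \<odot>\<^bsub>M\<^esub> u)" by (simp add: smult subset_iff)
        with submoduleE(4)[OF H(1) a u(1)] show "a \<odot>\<^bsub>?Q\<^esub> x \<in> ?K" by simp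
      qed
      then have K: "?K = carrier ?Q" using H(2) S(3) by (intro gen) auto
      show "carrier M \<subseteq> H"
      proof
        fix x assume x: "x \<in> carrier M"
        then have "N +>\<^bsub>M\<^esub> x \<in> ?K" unfolding K carr by (rule imageI)
        \<comment> \<open>Equality of cosets only says that x and h differ by an element of N; as N
          lies in \<open>H\<close>, this puts x in \<open>H\<close>.\<close>
        then obtain h where h: "h \<in> H" "N +>\<^bsub>M\<^esub> h = N +>\<^bsub>M\<^esub> x" by force
        with x have "x \<in> N +>\<^bsub>M\<^esub> h" by (intro S.a_repr_independenceD)
        then obtain m where "m \<in> N" "x = m \<oplus>\<^bsub>M\<^esub> h" by (auto simp: a_r_coset_def')
        with h(1) H(2) show "x \<in> H" by (auto intro: submoduleE(5)[OF H(1)])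
      qed
    qed
    with S show "\<exists>S. finite S \<and> S \<subseteq> carrier M \<and>
        (\<forall>H. submodule H R M \<and> N \<union> S \<subseteq> H \<longrightarrow> H = carrier M)" by blast
  next
    assume "\<exists>S. finite S \<and> S \<subseteq> carrier M \<and>
        (\<forall>H. submodule H R M \<and> N \<union> S \<subseteq> H \<longrightarrow> H = carrier M)"
    then obtain S where S: "finite S" "S \<subseteq> carrier M"
      and gen: "\<And>H. submodule H R M \<Longrightarrow> N \<union> S \<subseteq> H \<Longrightarrow> H = carrier M" by blast
    let ?T = "(\<lambda>x. N +>\<^bsub>M\<^esub> x) ` S"
    have "K = carrier ?Q" if K: "submodule K R ?Q" "?T \<subseteq> K" for K
    proof
      show "K \<subseteq> carrier ?Q" by (rule Q.submoduleE(1)[OF K(1)])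
      \<comment> \<open>The inverse image of \<open>K\<close> contains N because N is the zero of
        the quotient.\<close>
      let ?H = "{x \<in> carrier M. N +>\<^bsub>M\<^esub> x \<in> K}"
      have N_mem: "N +>\<^bsub>M\<^esub> x \<in> K" if "x \<in> N" for x
        using that Q.submodule_zero[OF K(1)] by (simp add: S.a_rcos_const zero)
      have "submodule ?H R M"
      proof (rule submoduleI_smult)
        fix x y assume xy: "x \<in> ?H" "y \<in> ?H"
        then have "(N +>\<^bsub>M\<^esub> x) \<oplus>\<^bsub>?Q\<^esub> (N +>\<^bsub>M\<^esub> y) \<in> K" by (blast intro: Q.submoduleE(5)[OF K(1)])
        with xy show "x \<oplus>\<^bsub>M\<^esub> y \<in> ?H" by (simp add: add)
      next
        fix a x assume ax: "a \<in> carrier R" "x \<in> ?H"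
        then have "a \<odot>\<^bsub>?Q\<^esub> (N +>\<^bsub>M\<^esub> x) \<in> K" by (blast intro: Q.submoduleE(4)[OF K(1)])
        with ax show "a \<odot>\<^bsub>M\<^esub> x \<in> ?H" by (simp add: smult)
      qed (use N_mem S.zero_closed in auto)
      moreover have "N \<union> S \<subseteq> ?H" using N_mem S(2) K(2) S.a_subset by auto
      ultimately have "?H = carrier M" by (rule gen)
      then show "carrier ?Q \<subseteq> K" unfolding carr by auto
    qed
    moreover have "finite ?T" "?T \<subseteq> carrier ?Q" using S carr by auto
    ultimately show "fin_gen_module R ?Q" unfolding Q.fin_gen_module_iff by blast
  qed
qed

end


section \<open>Rees algebras\<close>

context cring
begin

lemma coeff_rees_mem:
  assumes "p \<in> rees R J"
  shows "up_ring.coeff (UP R) p k \<in> ideal_pow R J k" "p \<in> carrier (UP R)"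
  using assms by (auto simp: rees_def)

lemma monom_mem_rees:
  assumes "ideal J R" "x \<in> ideal_pow R J k"
  shows "up_ring.monom (UP R) x k \<in> rees R J"
proof -
  interpret P: UP_cring R "UP R" by unfold_locales
  interpret Q: ideal "ideal_pow R J k" R for k by (rule ideal_pow_is_ideal[OF assms(1)])
  show ?thesis using assms(2) Q.Icarr by (auto simp: rees_def)
qed

text \<open>A polynomial is the finite sum of its monomials, and for a member of R[Jt] the
  coefficient in degree k lies in J^k. So monomials are all that has to be checked.\<close>

lemma submodule_rees_eqI:
  assumes J: "ideal J R" and H: "submodule H R (rees_algebra R J)"
    and monom: "\<And>k x. x \<in> ideal_pow R J k \<Longrightarrow> up_ring.monom (UP R) x k \<in> H"
  shows "H = carrier (rees_algebra R J)"
proof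
  interpret P: UP_cring R "UP R" by unfold_locales
  interpret M: module R "rees_algebra R J" by (rule rees_algebra_is_module[OF J])
  show sub: "H \<subseteq> carrier (rees_algebra R J)" by (rule M.submoduleE(1)[OF H])
  show "carrier (rees_algebra R J) \<subseteq> H"
  proof
    fix p assume "p \<in> carrier (rees_algebra R J)"
    then have p: "p \<in> rees R J" by (simp add: rees_algebra_def)
    have "(\<Oplus>\<^bsub>UP R\<^esub>k\<in>{..deg R p}. up_ring.monom (UP R) (up_ring.coeff (UP R) p k) k) \<in> H"
      by (rule P.finsum_mem)
        (use sub M.submodule_zero[OF H] M.submoduleE(5)[OF H] monom coeff_rees_mem[OF p]
          in \<open>auto simp: rees_algebra_def rees_def\<close>)
    then show "p \<in> H" using P.up_repr coeff_rees_mem(2)[OF p] by simp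
  qed
qed

section \<open>Finite generation of R[Jt]/R[It]\<close>

lemma fin_gen_rees_quot_if_ideal_pow_eq:
  assumes "noetherian_ring R" and I: "ideal I R" and J: "ideal J R" and IJ: "I \<subseteq> J"
    and "1 \<le> n" "ideal_pow R I n = ideal_pow R J n"
  shows "fin_gen_module R (quot_module (rees_algebra R J) (rees R I))"
proof -
  interpret P: UP_cring R "UP R" by unfold_locales
  interpret M: module R "rees_algebra R J" by (rule rees_algebra_is_module[OF J])
  interpret JJ: ideal "ideal_pow R J k" R for k by (rule ideal_pow_is_ideal[OF J])
  have "\<forall>k. \<exists>A\<subseteq>carrier R. finite A \<and> ideal_pow R J k = Idl A"
    using noetherian_ring.finetely_gen[OF assms(1)] JJ.is_ideal by blast
  then obtain A where A: "\<And>k. A k \<subseteq> carrier R" "\<And>k. finite (A k)" "\<And>k. ideal_pow R J k = Idl (A k)"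
    by metis
  \<comment> \<open>Generators of J^k placed in degree k, for the finitely many degrees in which J^k
    and I^k may differ.\<close>
  define S where "S = (\<Union>k<n. (\<lambda>a. up_ring.monom (UP R) a k) ` A k)"
  have "finite S" using A(2) by (simp add: S_def)
  moreover have "S \<subseteq> carrier (rees_algebra R J)"
    using monom_mem_rees[OF J] genideal_self[OF A(1)] by (auto simp: S_def rees_algebra_def A(3))
  moreover have "H = carrier (rees_algebra R J)"
    if H: "submodule H R (rees_algebra R J)" "rees R I \<union> S \<subseteq> H" for H
  proof (rule submodule_rees_eqI[OF J H(1)])
    fix k x assume x: "x \<in> ideal_pow R J k"
    show "up_ring.monom (UP R) x k \<in> H"
    proof (cases "k < n")
      case True
      \<comment> \<open>For fixed k the x with x t^k in \<open>H\<close> form an ideal. It contains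
        the generators \<open>A k\<close>, hence all of J^k.\<close>
      let ?L = "{x \<in> carrier R. up_ring.monom (UP R) x k \<in> H}"
      have "ideal ?L R"
      proof (rule idealI)
        have smult: "a \<otimes> x \<in> ?L" if "x \<in> ?L" "a \<in> carrier R" for a x
          using that M.submoduleE(4)[OF H(1), of a "up_ring.monom (UP R) x k"]
          by (simp add: rees_algebra_def P.monom_mult_smult)
        then show "\<And>x a. x \<in> ?L \<Longrightarrow> a \<in> carrier R \<Longrightarrow> a \<otimes> x \<in> ?L"
          "\<And>x a. x \<in> ?L \<Longrightarrow> a \<in> carrier R \<Longrightarrow> x \<otimes> a \<in> ?L"
          by (auto simp: m_comm)
        show "subgroup ?L (add_monoid R)"
        proof (rule add.subgroupI)
          show "?L \<noteq> {}" using M.submodule_zero[OF H(1)] by (auto simp: rees_algebra_def intro!: exI[of _ \<zero>])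
          fix x y assume x: "x \<in> ?L"
          then have "\<ominus> x = \<ominus> \<one> \<otimes> x" by (simp add: l_minus)
          then show "\<ominus> x \<in> ?L" using smult[OF x, of "\<ominus> \<one>"] by simp
          assume "y \<in> ?L"
          with x show "x \<oplus> y \<in> ?L"
            using M.submoduleE(5)[OF H(1), of "up_ring.monom (UP R) x k" "up_ring.monom (UP R) y k"]
            by (simp add: rees_algebra_def)
        qed auto
      qed (rule ring_axioms)
      moreover have "A k \<subseteq> ?L" using A(1) H(2) True unfolding S_def by blast
      ultimately have "Idl (A k) \<subseteq> ?L" by (rule genideal_minimal)
      with x show ?thesis unfolding A(3) by blast
    next
      case False
      \<comment> \<open>From degree \<open>n\<close> on, the powers agree, so the monomial already
        lies in R[It].\<close>
      then have "x \<in> ideal_pow R I k"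
        using x ideal_pow_eq_mono[OF I J IJ assms(5) _ assms(6), of k] by simp
      then show ?thesis using monom_mem_rees[OF I] H(2) by auto
    qed
  qed
  ultimately show ?thesis
    unfolding M.fin_gen_quot_module_iff[OF rees_submodule[OF I J IJ]] by blast
qed

lemma ideal_pow_eq_if_fin_gen_rees_quot:
  assumes I: "ideal I R" and J: "ideal J R" and IJ: "I \<subseteq> J"
    and "fin_gen_module R (quot_module (rees_algebra R J) (rees R I))"
  shows "\<exists>n\<ge>1. ideal_pow R I n = ideal_pow R J n"
proof -
  interpret P: UP_cring R "UP R" by unfold_locales
  interpret M: module R "rees_algebra R J" by (rule rees_algebra_is_module[OF J])
  interpret II: ideal "ideal_pow R I k" R for k by (rule ideal_pow_is_ideal[OF I])
  interpret JJ: ideal "ideal_pow R J k" R for k by (rule ideal_pow_is_ideal[OF J])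
  from assms(4)[unfolded M.fin_gen_quot_module_iff[OF rees_submodule[OF I J IJ]]]
  obtain S where S: "finite S" "S \<subseteq> carrier (rees_algebra R J)"
    and gen: "\<forall>H. submodule H R (rees_algebra R J) \<and> rees R I \<union> S \<subseteq> H \<longrightarrow>
      H = carrier (rees_algebra R J)"
    by (elim exE conjE)
  \<comment> \<open>A degree above those of all generators. Inserting 0 keeps \<open>Max\<close>
    meaningful for empty \<open>S\<close>, and \<open>Suc\<close> makes \<open>n\<close> both
    strictly larger and positive.\<close>
  define n where "n = Suc (Max (insert 0 (deg R ` S)))"
  \<comment> \<open>The test submodule constrains only the coefficient in degree \<open>n\<close>.
    It contains R[It] by definition and \<open>S\<close> because that coefficient vanishes there;
    once it is everything, x t^n for x in J^n yields x in I^n.\<close>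
  define H where "H = {p \<in> rees R J. up_ring.coeff (UP R) p n \<in> ideal_pow R I n}"
  have "submodule H R (rees_algebra R J)"
  proof (rule M.submoduleI_smult)
    show "H \<subseteq> carrier (rees_algebra R J)" by (auto simp: H_def rees_algebra_def)
    show "\<zero>\<^bsub>rees_algebra R J\<^esub> \<in> H" by (simp add: H_def rees_algebra_def rees_def)
  next
    fix p q assume "p \<in> H" "q \<in> H"
    then show "p \<oplus>\<^bsub>rees_algebra R J\<^esub> q \<in> H" by (simp add: H_def rees_algebra_def rees_def)
  next
    fix a p assume "a \<in> carrier R" "p \<in> H"
    then show "a \<odot>\<^bsub>rees_algebra R J\<^esub> p \<in> H"
      by (simp add: H_def rees_algebra_def rees_def II.I_l_closed JJ.I_l_closed)
  qed
  moreover have "rees R I \<union> S \<subseteq> H"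
  proof
    fix p assume p: "p \<in> rees R I \<union> S"
    show "p \<in> H"
    proof (cases "p \<in> rees R I")
      case True
      then show ?thesis using ideal_pow_mono[OF J IJ] by (auto simp: H_def rees_def)
    next
      case False
      with p have "p \<in> S" by simp
      then have "p \<in> rees R J" "deg R p < n"
        using S by (auto simp: rees_algebra_def n_def less_Suc_eq_le)
      then show ?thesis by (simp add: H_def coeff_rees_mem(2) P.deg_aboveD)
    qed
  qed
  ultimately have H: "H = carrier (rees_algebra R J)" using gen by blast
  have "ideal_pow R J n \<subseteq> ideal_pow R I n"
  proof
    fix x assume x: "x \<in> ideal_pow R J n"
    then have "up_ring.monom (UP R) x n \<in> H" unfolding H using monom_mem_rees[OF J] by (simp add: rees_algebra_def)
    with x show "x \<in> ideal_pow R I n" by (simp add: H_def)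
  qed
  with ideal_pow_mono[OF J IJ] have "ideal_pow R I n = ideal_pow R J n" by blast
  moreover have "1 \<le> n" by (simp add: n_def)
  ultimately show ?thesis by blast
qed

end

theorem lemma5p2:
  fixes R :: "('a, 'b) ring_scheme"
  assumes "cring R" and "\<one>\<^bsub>R\<^esub> \<noteq> \<zero>\<^bsub>R\<^esub>"
  shows
    "((\<forall>I J n. ideal I R \<and> ideal J R \<and> I \<subset> J \<and> 2 \<le> n \<and> ideal_pow R I n = ideal_pow R J n \<longrightarrow>
        ideal_prod R I (ideal_pow R J (n - 1)) = ideal_pow R J n \<and> reduction R I J) \<and>
      (\<forall>J. ideal J R \<and> \<not> (\<exists>I. ideal I R \<and> I \<subset> J \<and> reduction R I J) \<longrightarrow> big_ideal R J) \<and>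
      (\<exists>(S :: complex ring) I J n. cring S \<and> \<one>\<^bsub>S\<^esub> \<noteq> \<zero>\<^bsub>S\<^esub> \<and>
        ideal I S \<and> ideal J S \<and> I \<subset> J \<and> 2 \<le> n \<and>
        ideal_prod S I (ideal_pow S J (n - 1)) = ideal_pow S J n \<and>
        ideal_pow S I n \<noteq> ideal_pow S J n)) \<and>
     (\<forall>I J n. ideal I R \<and> ideal J R \<and> I \<subset> J \<and> 1 \<le> n \<and> ideal_pow R I n = ideal_pow R J n \<longrightarrow>
        (\<forall>m\<ge>n. ideal_pow R I m = ideal_pow R J m)) \<and>
     (noetherian_ring R \<longrightarrow>
       (\<forall>I J. ideal I R \<and> ideal J R \<and> I \<subset> J \<longrightarrow>
         ((\<exists>n\<ge>1. ideal_pow R I n = ideal_pow R J n) \<longleftrightarrow>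
          fin_gen_module R (quot_module (rees_algebra R J) (rees R I)))))"

proof -
  interpret cring R by (rule assms(1))
  show ?thesis
  proof (intro conjI allI impI; (elim conjE)?)
    fix I J and n :: nat
    assume I: "ideal I R" and J: "ideal J R" and IJ: "I \<subset> J"
      and n: "2 \<le> n" "ideal_pow R I n = ideal_pow R J n"
    show "ideal_prod R I (ideal_pow R J (n - 1)) = ideal_pow R J n" "reduction R I J"
      by (rule reduction_if_ideal_pow_eq[OF I J psubset_imp_subset[OF IJ] n])+
  next
    fix J
    assume "ideal J R" "\<nexists>I. ideal I R \<and> I \<subset> J \<and> reduction R I J"
    then show "big_ideal R J" by (rule big_ideal_if_no_reduction)
  next
    show "\<exists>(S :: complex ring) I J n. cring S \<and> \<one>\<^bsub>S\<^esub> \<noteq> \<zero>\<^bsub>S\<^esub> \<and>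
        ideal I S \<and> ideal J S \<and> I \<subset> J \<and> 2 \<le> n \<and>
        ideal_prod S I (ideal_pow S J (n - 1)) = ideal_pow S J n \<and>
        ideal_pow S I n \<noteq> ideal_pow S J n"
      by (rule reduction_with_different_powers)
  next
    fix I J and n m :: nat
    assume I: "ideal I R" and J: "ideal J R" and IJ: "I \<subset> J"
      and n: "1 \<le> n" "ideal_pow R I n = ideal_pow R J n" "n \<le> m"
    show "ideal_pow R I m = ideal_pow R J m"
      by (rule ideal_pow_eq_mono[OF I J psubset_imp_subset[OF IJ] n(1,3,2)])
  next
    fix I J
    assume R: "noetherian_ring R" and I: "ideal I R" and J: "ideal J R" and IJ: "I \<subset> J"
    note IJ = psubset_imp_subset[OF IJ]
    show "(\<exists>n\<ge>1. ideal_pow R I n = ideal_pow R J n) \<longleftrightarrow>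
        fin_gen_module R (quot_module (rees_algebra R J) (rees R I))"
    proof
      assume "\<exists>n\<ge>1. ideal_pow R I n = ideal_pow R J n"
      then show "fin_gen_module R (quot_module (rees_algebra R J) (rees R I))"
        by (elim exE conjE) (rule fin_gen_rees_quot_if_ideal_pow_eq[OF R I J IJ])
    qed (rule ideal_pow_eq_if_fin_gen_rees_quot[OF I J IJ])
  qed
qed

end
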